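(* Let $\gamma_1,\gamma_2,\gamma_3,\varrho,\Upsilon,\mu\in\mathbb{C}$ have positive real parts. For $Y>B$, the bivariate H–K Mittag-Leffler function has the following image under the Riemann–Liouville fractional derivative operator: $${}_{Y}D^{\mu}_{B^+}\left[(Y-B)^{\varrho-1}E_{\varrho,\Upsilon}^{(\gamma_1;\gamma_2;\gamma_3)}(X,w(Y-B))\right]=(Y-B)^{\varrho-\mu-1}E_{\varrho-\mu,\Upsilon}^{(\gamma_1;\gamma_2;\gamma_3)}(X,w(Y-B)).$$
   Context: $(a)_k$ is the Pochhammer symbol. The bivariate H–K Mittag-Leffler function is $$E_{\varrho,\Upsilon}^{(\gamma_1;\gamma_2;\gamma_3)}(X,Y)=\sum_{s=0}^\infty\sum_{r=0}^\infty\frac{(\gamma_1)_{2s}(\gamma_2)_{s+r}X^sY^{\Upsilon r}}{(\gamma_3)_s\,\Gamma(\varrho+\Upsilon r)\,r!\,s!},$$ for complex $\Upsilon,\varrho,\gamma_1,\gamma_2,\gamma_3$ with positive real parts; on the right-hand side of the claim the same series is used with $\varrho$ replaced by $\varrho-\mu$. The Riemann–Liouville fractional derivative of order $\mu$, $\mathrm{Re}(\mu)>0$, is ${}_{Y}D^{\mu}_{B^+}(f)=\left(\frac{d}{dY}\right)^n{}_{Y}I^{n-\mu}_{B^+}(f)$ with $n=[\mathrm{Re}(\mu)]+1$ ($[\cdot]$ the integral part), where ${}_{Y}I^{\lambda}_{B^+}(f)=\frac{1}{\Gamma(\lambda)}\int_B^Y(Y-t)^{\lambda-1}f(t)\,dt$,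 $Y>B$. Here $w$ is a constant.
   Formalization: The printed double series diverges for every X ≠ 0, so the identity is proved as one of formal power series in X (for the coefficient of each X^s, a convergent series in r) and literally at X = 0; for X ≠ 0 the literal version only equates conventional zero values. *)

theory Defs
  imports "HOL-Analysis.Analysis" "HOL-Computational_Algebra.Formal_Power_Series"
begin

section \<open>The bivariate H--K Mittag-Leffler function\<close>

text \<open>
  The coefficient of \<open>X\<^sup>s\<close> in the term with indices \<open>s, r\<close>.  The entire function \<^const>\<open>rGamma\<close>
  is \<open>1/\<Gamma>\<close>, with the customary value 0 at the poles of \<open>\<Gamma>\<close>; poles can occur because
  \<open>\<rho> - \<mu>\<close> need not have positive real part.  The power \<open>Y\<^bsup>\<Upsilon>r\<^esup>\<close> (principal branch) is written
  \<open>(Y powr \<Upsilon>) ^ r\<close>, which agrees with \<open>Y powr (\<Upsilon> * r)\<close> for \<open>Y \<noteq> 0\<close> and has the right value 1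
  for \<open>Y = 0\<close>, \<open>r = 0\<close>, where \<open>0 powr 0 = 0\<close>.
\<close>

definition HK_term ::
  "complex \<Rightarrow> complex \<Rightarrow> complex \<Rightarrow> complex \<Rightarrow> complex \<Rightarrow> complex \<Rightarrow> nat \<Rightarrow> nat \<Rightarrow> complex" where
  "HK_term \<gamma>1 \<gamma>2 \<gamma>3 \<rho> \<Upsilon> Y s r =
     pochhammer \<gamma>1 (2 * s) * pochhammer \<gamma>2 (s + r) * (Y powr \<Upsilon>) ^ r * rGamma (\<rho> + \<Upsilon> * of_nat r)
       / (pochhammer \<gamma>3 s * fact r * fact s)"

text \<open>
  The double series, summed over all pairs of indices (absolute convergence).

  Pitfall: if \<open>\<gamma>1, \<gamma>2, \<gamma>3\<close> have positive real parts and \<open>X \<noteq> 0\<close>, the terms with a fixed \<open>r\<close> with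
  \<open>rGamma (\<rho> + \<Upsilon> * of_nat r) \<noteq> 0\<close> (and \<open>Y \<noteq> 0\<close> or \<open>r = 0\<close>) grow like \<open>4\<^sup>s s! \<bar>X\<bar>\<^sup>s\<close> up to powers
  of \<open>s\<close>, so the series diverges and \<^const>\<open>infsum\<close> returns 0.  As an expansion in \<open>X\<close> the series
  is therefore only formal; \<open>HK_fps\<close> is the same series as a formal power series in \<open>X\<close>.  Its
  coefficients are series in \<open>r\<close>, which converge absolutely for \<open>Re \<Upsilon> > 0\<close>.
\<close>

definition HK_ML ::
  "complex \<Rightarrow> complex \<Rightarrow> complex \<Rightarrow> complex \<Rightarrow> complex \<Rightarrow> complex \<Rightarrow> complex \<Rightarrow> complex" where
  "HK_ML \<gamma>1 \<gamma>2 \<gamma>3 \<rho> \<Upsilon> X Y = (\<Sum>\<^sub>\<infinity>(s, r)\<in>UNIV. HK_term \<gamma>1 \<gamma>2 \<gamma>3 \<rho> \<Upsilon> Y s r * X ^ s)"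

definition HK_fps ::
  "complex \<Rightarrow> complex \<Rightarrow> complex \<Rightarrow> complex \<Rightarrow> complex \<Rightarrow> complex \<Rightarrow> complex fps" where
  "HK_fps \<gamma>1 \<gamma>2 \<gamma>3 \<rho> \<Upsilon> Y = Abs_fps (\<lambda>s. \<Sum>r. HK_term \<gamma>1 \<gamma>2 \<gamma>3 \<rho> \<Upsilon> Y s r)"


section \<open>The Riemann--Liouville operators\<close>

definition RL_integral :: "complex \<Rightarrow> real \<Rightarrow> (real \<Rightarrow> complex) \<Rightarrow> real \<Rightarrow> complex" where
  "RL_integral \<alpha> B f y =
     1 / Gamma \<alpha> * integral {B..y} (\<lambda>t. complex_of_real (y - t) powr (\<alpha> - 1) * f t)"

definition RL_order :: "complex \<Rightarrow> nat" where
  "RL_order \<mu> = nat \<lfloor>Re \<mu>\<rfloor> + 1"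

definition nth_derivative :: "nat \<Rightarrow> (real \<Rightarrow> complex) \<Rightarrow> real \<Rightarrow> complex" where
  "nth_derivative n g = ((\<lambda>h y. vector_derivative h (at y)) ^^ n) g"

definition RL_derivative :: "complex \<Rightarrow> real \<Rightarrow> (real \<Rightarrow> complex) \<Rightarrow> real \<Rightarrow> complex" where
  "RL_derivative \<mu> B f y =
     nth_derivative (RL_order \<mu>) (RL_integral (of_nat (RL_order \<mu>) - \<mu>) B f) y"

text \<open>
  \<^const>\<open>integral\<close> and \<^const>\<open>vector_derivative\<close> are total functions; the following says that the
  integral and the derivatives in \<open>RL_derivative\<close> exist on \<open>(B, \<infinity>)\<close>.
\<close>

definition RL_differentiable :: "complex \<Rightarrow> real \<Rightarrow> (real \<Rightarrow> complex) \<Rightarrow> bool" where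
  "RL_differentiable \<mu> B f \<longleftrightarrow>
     (\<forall>y>B. (\<lambda>t. complex_of_real (y - t) powr (of_nat (RL_order \<mu>) - \<mu> - 1) * f t)
               absolutely_integrable_on {B..y}) \<and>
     (\<forall>k<RL_order \<mu>. \<forall>y>B.
        nth_derivative k (RL_integral (of_nat (RL_order \<mu>) - \<mu>) B f) differentiable (at y))"

end

theory Submission
  imports Defs
begin

text \<open>
  Termwise, the operator of order \<open>\<mu>\<close> acts on powers: the Beta integral gives
  \<open>I\<^sup>\<alpha> x\<^bsup>\<beta>-1\<^esup> = \<Gamma>(\<beta>)/\<Gamma>(\<beta>+\<alpha>) x\<^bsup>\<beta>+\<alpha>-1\<^esup>\<close> with \<open>\<beta> = \<rho> + \<Upsilon>r\<close>, so \<open>I\<^sup>\<alpha>\<close> replaces \<open>\<rho>\<close> by \<open>\<rho> + \<alpha>\<close> in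
  \<open>x\<^bsup>\<rho>-1\<^esup> \<Sum> a\<^sub>r x\<^bsup>\<Upsilon>r\<^esup>/\<Gamma>(\<rho>+\<Upsilon>r)\<close>, and every derivative lowers \<open>\<rho>\<close> by one.  The interchanges with the sum
  rest on \<open>\<Sum> a\<^sub>r z\<^sup>r/\<Gamma>(\<rho>+\<Upsilon>r)\<close> being entire.  This follows from the ratio test without Stirling's
  formula: the quotient of consecutive reciprocal Gamma values is \<open>B(\<rho>+\<Upsilon>r, \<Upsilon>)/\<Gamma>(\<Upsilon>)\<close>, and
  \<open>\<bar>B(a, b)\<bar> \<le> B(Re a, Re b)\<close> tends to 0 as \<open>Re a \<rightarrow> \<infinity>\<close>.

  The double series over \<open>(s, r)\<close> has sum 0 for every \<open>X \<noteq> 0\<close>, as it either diverges or has only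
  zero terms; for \<open>X = 0\<close> it is the coefficient of \<open>X\<^sup>0\<close>.
\<close>

section \<open>The complex Beta integral\<close>

text \<open>\<open>powr\<close> is nonzero at negative bases. Cutting the power off at 0 builds the
  range of integration into the integrand, so that convolutions are integrals over the whole
  line.\<close>

definition pos_powr :: "complex \<Rightarrow> real \<Rightarrow> complex" where
  "pos_powr p t = (if t > 0 then of_real t powr p else 0)"

lemma pos_powr_nonpos: "t \<le> 0 \<Longrightarrow> pos_powr p t = 0"
  by (simp add: pos_powr_def)

lemma borel_measurable_pos_powr [measurable]: "pos_powr p \<in> borel_measurable borel"
proof -
  have "pos_powr p = (\<lambda>t. indicator {0<..} t *\<^sub>R exp (p * of_real (ln t)))"
    by (auto simp: pos_powr_def powr_def Ln_of_real fun_eq_iff)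
  then show ?thesis
    by simp
qed

lemma pos_powr_mult: "x > 0 \<Longrightarrow> pos_powr p (x * t) = of_real x powr p * pos_powr p t"
  by (auto simp: pos_powr_def zero_less_mult_iff powr_times_real)

lemma norm_pos_powr: "of_real (norm (pos_powr p t)) = pos_powr (of_real (Re p)) t"
  by (simp add: pos_powr_def norm_powr_real_powr powr_of_real)

text \<open>Fubini's theorem is applied over \<open>lborel\<close>; Borel measurability of the
  integrand lets the Gamma integral pass to it from the completed measure.\<close>

lemma has_bochner_integral_Gamma:
  assumes "Re z > 0"
  shows "has_bochner_integral lborel (\<lambda>t. pos_powr (z - 1) t * of_real (exp (- t))) (Gamma z)"
proof -
  let ?f = "\<lambda>t. complex_of_real t powr (z - 1) / of_real (exp t)"
  let ?g = "\<lambda>t. pos_powr (z - 1) t * of_real (exp (- t))"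
  have fg: "(\<lambda>t. indicator {0<..} t *\<^sub>R ?f t) = ?g"
    by (auto simp: pos_powr_def fun_eq_iff exp_minus divide_inverse)
  have abs: "?f absolutely_integrable_on {0<..}"
    by (rule absolutely_integrable_Gamma_integral') fact
  have g: "?g \<in> borel_measurable lborel"
    by simp
  have "integrable lebesgue ?g"
    using abs unfolding set_integrable_def fg .
  moreover have "integral\<^sup>L lebesgue ?g = Gamma z"
    using set_lebesgue_integral_eq_integral(2)[OF abs] Gamma_integral_complex'[OF assms]
    by (simp add: set_lebesgue_integral_def fg integral_unique)
  ultimately show ?thesis
    using g by (simp add: has_bochner_integral_iff integrable_completion integral_completion)
qed

definition beta_kernel :: "complex \<Rightarrow> complex \<Rightarrow> real \<Rightarrow> real \<Rightarrow> complex" where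
  "beta_kernel a b x t = pos_powr (a - 1) t * pos_powr (b - 1) (x - t)"

lemma borel_measurable_beta_kernel [measurable]: "beta_kernel a b x \<in> borel_measurable borel"
  unfolding beta_kernel_def by measurable

lemma beta_kernel_nonpos: "x \<le> 0 \<Longrightarrow> beta_kernel a b x t = 0"
  by (auto simp: beta_kernel_def pos_powr_def)

text \<open>Embedded in the complex numbers, the modulus is a kernel again, with real exponents, so
  one integral formula yields both values and L1 norms.\<close>

lemma norm_beta_kernel:
  "of_real (norm (beta_kernel a b x t)) = beta_kernel (of_real (Re a)) (of_real (Re b)) x t"
  by (simp add: beta_kernel_def norm_mult norm_pos_powr)

lemma beta_kernel_scale:
  assumes "x > 0"
  shows "beta_kernel a b x (x * t) = of_real x powr (a + b - 2) * beta_kernel a b 1 t"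
proof -
  have "x - x * t = x * (1 - t)"
    by (simp add: algebra_simps)
  moreover have "of_real x powr (a + b - 2) = complex_of_real x powr (a - 1) * of_real x powr (b - 1)"
    by (simp flip: powr_add)
  ultimately show ?thesis
    using assms by (simp add: beta_kernel_def pos_powr_mult)
qed

lemma integrable_beta_kernel_1:
  assumes "Re a > 0" "Re b > 0"
  shows "integrable lborel (beta_kernel a b 1)"
proof (rule Bochner_Integration.integrable_bound)
  show "integrable lborel (\<lambda>t. indicat_real {0..1} t *\<^sub>R (t powr (Re a - 1) * (1 - t) powr (Re b - 1)))"
    using integrable_Beta[OF assms] by (simp add: set_integrable_def)
  show "AE t in lborel. norm (beta_kernel a b 1 t)
      \<le> norm (indicat_real {0..1} t *\<^sub>R (t powr (Re a - 1) * (1 - t) powr (Re b - 1)))"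
    by (rule AE_I2) (auto simp: beta_kernel_def pos_powr_def norm_mult norm_powr_real_powr simp flip: of_real_diff)
qed simp

text \<open>Substituting \<open>x * t\<close> for \<open>t\<close> reduces \<open>x > 0\<close> to
  \<open>x = 1\<close>. The constant stays unevaluated here: \<open>integral_beta_kernel_1\<close>
  derives its value from this formula.\<close>

lemma has_bochner_integral_beta_kernel_scaled:
  assumes "Re a > 0" "Re b > 0"
  shows "has_bochner_integral lborel (beta_kernel a b x)
    (pos_powr (a + b - 1) x * integral\<^sup>L lborel (beta_kernel a b 1))"
proof (cases "x > 0")
  case True
  let ?C = "integral\<^sup>L lborel (beta_kernel a b 1)"
  \<comment> \<open>The differential contributes the factor \<open>x\<close> that raises the
    exponent \<open>a + b - 2\<close> of \<open>beta_kernel_scale\<close> to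
    \<open>a + b - 1\<close>.\<close>
  have "complex_of_real x powr (a + b - 1) = of_real x powr (a + b - 2) * of_real x powr 1"
    by (subst powr_add [symmetric]) (simp add: algebra_simps)
  then have "(pos_powr (a + b - 1) x * ?C) /\<^sub>R \<bar>x\<bar> = of_real x powr (a + b - 2) * ?C"
    using True by (simp add: pos_powr_def scaleR_conv_of_real)
  moreover have "has_bochner_integral lborel (beta_kernel a b 1) ?C"
    using integrable_beta_kernel_1[OF assms] by (rule has_bochner_integral_integrable)
  ultimately show ?thesis
    using True
    by (subst lborel_has_bochner_integral_real_affine_iff[where c = x and t = 0])
       (auto simp: beta_kernel_scale intro: has_bochner_integral_mult_right)
next
  case False
  then have "beta_kernel a b x = (\<lambda>_. 0)"
    by (auto simp: fun_eq_iff beta_kernel_nonpos)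
  then show ?thesis
    using False by (simp add: pos_powr_nonpos has_bochner_integral_iff)
qed

text \<open>Fubini's theorem for \<open>t\<^bsup>a-1\<^esup> (u - t)\<^bsup>b-1\<^esup> e\<^bsup>-u\<^esup>\<close> on \<open>0 < t < u\<close>.\<close>

lemma integral_beta_kernel_1:
  assumes "Re a > 0" "Re b > 0"
  shows "integral\<^sup>L lborel (beta_kernel a b 1) = Beta a b"
proof -
  \<comment> \<open>A function of both exponents, since it is used at \<open>a\<close>,
    \<open>b\<close> for the value and at their real parts for integrability.\<close>
  define C where "C = (\<lambda>a b. integral\<^sup>L lborel (beta_kernel a b 1))"
  have K: "has_bochner_integral lborel (beta_kernel a b u) (pos_powr (a + b - 1) u * C a b)"
    if "Re a > 0" "Re b > 0" for a b u
    unfolding C_def using that by (rule has_bochner_integral_beta_kernel_scaled)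
  let ?f = "\<lambda>u t. beta_kernel a b u t * of_real (exp (- u))"
  let ?ra = "complex_of_real (Re a)" and ?rb = "complex_of_real (Re b)"
  have "integrable (lborel \<Otimes>\<^sub>M lborel) (case_prod ?f)"
  proof (rule lborel_pair.Fubini_integrable)
    show "case_prod ?f \<in> borel_measurable (lborel \<Otimes>\<^sub>M lborel)"
      unfolding beta_kernel_def by measurable
    \<comment> \<open>By the formula at real exponents, the inner L1 norm is a constant times the
      Gamma integrand at \<open>Re a + Re b\<close>.\<close>
    have "integrable lborel (\<lambda>u. complex_of_real (LINT t|lborel. norm (?f u t)))"
    proof -
      have "complex_of_real (LINT t|lborel. norm (?f u t)) =
          C ?ra ?rb * (pos_powr (?ra + ?rb - 1) u * of_real (exp (- u)))" for u
      proof -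
        have "complex_of_real (LINT t|lborel. norm (?f u t)) =
            (LINT t|lborel. beta_kernel ?ra ?rb u t * of_real (exp (- u)))"
          by (simp add: norm_mult norm_beta_kernel flip: integral_complex_of_real)
        also have "\<dots> = pos_powr (?ra + ?rb - 1) u * C ?ra ?rb * of_real (exp (- u))"
          using has_bochner_integral_integral_eq[OF K[of ?ra ?rb u]] assms by simp
        finally show ?thesis
          by simp
      qed
      moreover have "integrable lborel (\<lambda>u. pos_powr (?ra + ?rb - 1) u * of_real (exp (- u)))"
        using has_bochner_integral_Gamma[of "?ra + ?rb"] assms
        by (simp add: has_bochner_integral_iff)
      ultimately show ?thesis
        by simp
    qed
    then show "integrable lborel (\<lambda>u. LINT t|lborel. norm (case_prod ?f (u, t)))"
      by (simp add: complex_of_real_integrable_eq)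
    show "AE u in lborel. integrable lborel (\<lambda>t. case_prod ?f (u, t))"
      using has_bochner_integral_integrable K assms by (auto intro!: AE_I2 simp: has_bochner_integral_iff)
  qed
  then have "(LINT t|lborel. LINT u|lborel. ?f u t) = (LINT u|lborel. LINT t|lborel. ?f u t)"
    by (rule lborel_pair.Fubini_integral)
  also have "\<dots> = (LINT u|lborel. C a b * (pos_powr (a + b - 1) u * of_real (exp (- u))))"
    using has_bochner_integral_integral_eq[OF K[OF assms]] by (simp add: mult_ac)
  also have "\<dots> = C a b * Gamma (a + b)"
    using has_bochner_integral_integral_eq[OF has_bochner_integral_Gamma[of "a + b"]] assms by simp
  also have "(\<lambda>t. LINT u|lborel. ?f u t) = (\<lambda>t. Gamma b * (pos_powr (a - 1) t * of_real (exp (- t))))"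
  proof
    fix t
    \<comment> \<open>With \<open>u = t + v\<close> kernel and exponential separate, leaving a Gamma
      integral in \<open>v\<close>.\<close>
    have "(LINT u|lborel. ?f u t) = (LINT v|lborel. ?f (t + v) t)"
      by (subst lborel_integral_real_affine[where c = 1 and t = t]) auto
    also have "\<dots> = (LINT v|lborel. pos_powr (a - 1) t * of_real (exp (- t)) *
        (pos_powr (b - 1) v * of_real (exp (- v))))"
      by (simp only: beta_kernel_def minus_add_distrib exp_add of_real_mult mult_ac add_diff_cancel_left')
    also have "\<dots> = Gamma b * (pos_powr (a - 1) t * of_real (exp (- t)))"
      using has_bochner_integral_integral_eq[OF has_bochner_integral_Gamma[OF assms(2)]] by simp
    finally show "(LINT u|lborel. ?f u t) = \<dots>" .
  qed
  also have "(LINT t|lborel. Gamma b * (pos_powr (a - 1) t * of_real (exp (- t)))) = Gamma b * Gamma a"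
    using has_bochner_integral_integral_eq[OF has_bochner_integral_Gamma[OF assms(1)]] by simp
  finally have "Gamma b * Gamma a = C a b * Gamma (a + b)" .
  moreover have "Gamma (a + b) \<noteq> 0"
    using assms by (auto simp: Gamma_eq_zero_iff elim!: nonpos_Ints_cases' dest!: arg_cong[of _ _ Re])
  ultimately show ?thesis
    by (simp add: Beta_def C_def field_simps)
qed

lemma has_bochner_integral_beta_kernel:
  assumes "Re a > 0" "Re b > 0"
  shows "has_bochner_integral lborel (beta_kernel a b x) (pos_powr (a + b - 1) x * Beta a b)"
  using has_bochner_integral_beta_kernel_scaled[OF assms, of x] integral_beta_kernel_1[OF assms]
  by simp

section \<open>Series of reciprocal Gamma values\<close>

text \<open>Triangle inequality for the Beta integral: the modulus of the integrand is the integrand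
  at the real parts.\<close>

lemma norm_Beta_le:
  assumes "Re a > 0" "Re b > 0"
  shows "norm (Beta a b) \<le> Beta (Re a) (Re b)"
proof -
  have "complex_of_real (LINT t|lborel. norm (beta_kernel a b 1 t)) =
      (LINT t|lborel. beta_kernel (of_real (Re a)) (of_real (Re b)) 1 t)"
    by (simp add: norm_beta_kernel flip: integral_complex_of_real)
  also have "\<dots> = of_real (Beta (Re a) (Re b))"
    using assms by (simp add: integral_beta_kernel_1 Beta_complex_of_real)
  finally have "(LINT t|lborel. norm (beta_kernel a b 1 t)) = Beta (Re a) (Re b)"
    by (simp only: of_real_eq_iff)
  then show ?thesis
    using integral_norm_bound[of lborel "beta_kernel a b 1"] integral_beta_kernel_1[OF assms] by simp
qed

text \<open>At \<open>real n + 1\<close> the value is \<open>Gamma_series c n\<close> times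
  \<open>real n powr - c\<close>, and \<open>Gamma_series\<close> converges to
  \<open>Gamma c\<close>. Monotonicity in the first argument extends the limit to real
  \<open>x\<close>.\<close>

lemma Beta_real_tendsto_0:
  fixes c :: real
  assumes "c > 0"
  shows "((\<lambda>x. Beta x c) \<longlongrightarrow> 0) at_top"
proof -
  have "(\<lambda>n. Gamma_series c n * real n powr - c) \<longlonglongrightarrow> Gamma c * 0"
    using assms by (intro tendsto_mult Gamma_series_LIMSEQ tendsto_neg_powr filterlim_real_sequentially) auto
  moreover have "eventually (\<lambda>n. Gamma_series c n * real n powr - c = Beta (real n + 1) c) sequentially"
    using eventually_gt_at_top[of 0]
  proof eventually_elim
    case (elim n)
    have "pochhammer c (Suc n) = Gamma (c + real (Suc n)) / Gamma c"
      using assms by (intro pochhammer_Gamma) auto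
    moreover have "Gamma (real n + 1) = fact n"
      using Gamma_fact[of n, where 'a = real] by (simp add: add.commute)
    moreover have "exp (c * ln (real n)) = real n powr c"
      using elim by (simp add: powr_def)
    ultimately show ?case
      using elim assms by (simp add: Gamma_series_def Beta_def powr_minus field_simps)
  qed
  ultimately have lim: "(\<lambda>n. Beta (real n + 1) c) \<longlonglongrightarrow> 0"
    by (auto intro: Lim_transform_eventually)
  show ?thesis
  proof (rule tendstoI)
    fix e :: real assume "e > 0"
    with lim have "eventually (\<lambda>n. dist (Beta (real n + 1) c) 0 < e) sequentially"
      by (rule tendstoD)
    then obtain n where "dist (Beta (real n + 1) c) 0 < e"
      by (auto dest: eventually_happens)
    then have n: "Beta (real n + 1) c < e"
      by simp
    show "eventually (\<lambda>x. dist (Beta x c) 0 < e) at_top"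
      using eventually_ge_at_top[of "real n + 1"]
    proof eventually_elim
      case (elim x)
      then have "Beta x c \<le> Beta (real n + 1) c"
        using assms by (intro Beta_real_mono) auto
      moreover have "Beta x c \<ge> 0"
        using elim assms by (auto simp: Beta_def intro!: divide_nonneg_pos mult_nonneg_nonneg less_imp_le Gamma_real_pos)
      ultimately show ?case
        using n by simp
    qed
  qed
qed

lemma Gamma_nonzero_Re_pos: "Re z > 0 \<Longrightarrow> Gamma z \<noteq> 0"
  by (auto simp: Gamma_eq_zero_iff elim!: nonpos_Ints_cases')

lemma norm_rGamma_add_le:
  assumes "Re z > 0" "Re c > 0"
  shows "norm (rGamma (z + c)) \<le> norm (rGamma z) * (Beta (Re z) (Re c) / norm (Gamma c))"
proof -
  have "rGamma (z + c) = rGamma z * (Beta z c / Gamma c)"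
    using Gamma_nonzero_Re_pos assms
    by (simp add: Beta_altdef rGamma_inverse_Gamma field_simps)
  then show ?thesis
    using norm_Beta_le[OF assms] by (simp add: norm_mult norm_divide divide_right_mono mult_left_mono)
qed

text \<open>The ratio test looks only at large \<open>r\<close>, where
  \<open>\<sigma> + \<Upsilon> * of_nat r\<close> has positive real part; hence
  \<open>\<sigma>\<close> is arbitrary. The geometric growth of \<open>a\<close> and the powers of
  \<open>z\<close> are absorbed into \<open>L\<close>.\<close>

lemma summable_norm_rGamma_series:
  assumes "Re \<Upsilon> > 0" and a: "\<And>r. norm (a r) \<le> C * K ^ r" and "K \<ge> 0"
  shows "summable (\<lambda>r. norm (a r * rGamma (\<sigma> + \<Upsilon> * of_nat r) * z ^ r))"
proof -
  define L where "L = K * norm z"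
  have L: "L \<ge> 0"
    using \<open>K \<ge> 0\<close> by (simp add: L_def)
  let ?h = "\<lambda>r. L ^ r * norm (rGamma (\<sigma> + \<Upsilon> * of_nat r))"
  have filt: "filterlim (\<lambda>r. Re (\<sigma> + \<Upsilon> * of_nat r)) at_top sequentially"
    using \<open>Re \<Upsilon> > 0\<close>
    by (auto intro!: filterlim_tendsto_add_at_top[OF tendsto_const]
        filterlim_tendsto_pos_mult_at_top[OF tendsto_const] filterlim_real_sequentially)
  have "(\<lambda>r. L * (Beta (Re (\<sigma> + \<Upsilon> * of_nat r)) (Re \<Upsilon>) / norm (Gamma \<Upsilon>)))
      \<longlonglongrightarrow> L * (0 / norm (Gamma \<Upsilon>))"
    using \<open>Re \<Upsilon> > 0\<close> Gamma_nonzero_Re_pos[of \<Upsilon>]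
    by (intro tendsto_intros filterlim_compose[OF Beta_real_tendsto_0 filt]) auto
  then have "eventually (\<lambda>r. L * (Beta (Re (\<sigma> + \<Upsilon> * of_nat r)) (Re \<Upsilon>) / norm (Gamma \<Upsilon>)) < 1 / 2) sequentially"
    by (rule order_tendstoD) simp
  moreover have "eventually (\<lambda>r. Re (\<sigma> + \<Upsilon> * of_nat r) > 0) sequentially"
    using filt by (simp add: filterlim_at_top_dense)
  ultimately have "eventually (\<lambda>r. ?h (Suc r) \<le> 1 / 2 * ?h r) sequentially"
  proof eventually_elim
    case (elim r)
    let ?z = "\<sigma> + \<Upsilon> * of_nat r"
    have "?h (Suc r) = L ^ Suc r * norm (rGamma (?z + \<Upsilon>))"
      by (simp add: algebra_simps)
    also have "\<dots> \<le> L ^ Suc r * (norm (rGamma ?z) * (Beta (Re ?z) (Re \<Upsilon>) / norm (Gamma \<Upsilon>)))"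
      using elim \<open>Re \<Upsilon> > 0\<close> L by (intro mult_left_mono norm_rGamma_add_le) auto
    also have "\<dots> = L * (Beta (Re ?z) (Re \<Upsilon>) / norm (Gamma \<Upsilon>)) * ?h r"
      by simp
    also have "\<dots> \<le> 1 / 2 * ?h r"
      using elim L by (intro mult_right_mono) auto
    finally show ?case .
  qed
  then obtain N where "\<And>r. r \<ge> N \<Longrightarrow> ?h (Suc r) \<le> 1 / 2 * ?h r"
    by (auto simp: eventually_sequentially)
  then have "summable ?h"
    using L by (intro summable_ratio_test[of "1/2" N]) auto
  then have "summable (\<lambda>r. C * ?h r)"
    by (rule summable_mult)
  then show ?thesis
  proof (rule summable_comparison_test'[where N = 0])
    fix r
    have "norm (a r) * (norm (rGamma (\<sigma> + \<Upsilon> * of_nat r)) * norm z ^ r)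
        \<le> C * K ^ r * (norm (rGamma (\<sigma> + \<Upsilon> * of_nat r)) * norm z ^ r)"
      using a by (intro mult_right_mono) auto
    then show "norm (norm (a r * rGamma (\<sigma> + \<Upsilon> * of_nat r) * z ^ r)) \<le> C * ?h r"
      by (simp add: norm_mult norm_power L_def power_mult_distrib mult_ac)
  qed
qed

section \<open>Fractional power series and their derivatives\<close>

definition rGamma_series :: "(nat \<Rightarrow> complex) \<Rightarrow> complex \<Rightarrow> complex \<Rightarrow> complex \<Rightarrow> complex" where
  "rGamma_series a \<Upsilon> \<sigma> z = (\<Sum>r. a r * rGamma (\<sigma> + \<Upsilon> * of_nat r) * z ^ r)"

text \<open>For \<open>a r = 1\<close> the second factor is the two-parameter Mittag-Leffler
  function. Taking it at \<open>x powr \<Upsilon>\<close> makes the sum an entire function composed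
  with a power; at \<open>x = 0\<close> the value is 0, because \<open>0 powr p = 0\<close>.\<close>

definition fractional_series :: "(nat \<Rightarrow> complex) \<Rightarrow> complex \<Rightarrow> complex \<Rightarrow> real \<Rightarrow> complex" where
  "fractional_series a \<Upsilon> \<sigma> x = of_real x powr (\<sigma> - 1) * rGamma_series a \<Upsilon> \<sigma> (of_real x powr \<Upsilon>)"

text \<open>Only the coefficients are restricted; \<open>\<sigma>\<close> stays free because the
  operators shift it.\<close>

locale geometrically_bounded =
  fixes a :: "nat \<Rightarrow> complex" and \<Upsilon> :: complex and C K :: real
  assumes Re_\<Upsilon>: "Re \<Upsilon> > 0" and bound: "\<And>r. norm (a r) \<le> C * K ^ r" and K_nonneg: "K \<ge> 0"
begin

lemma summable_norm_terms: "summable (\<lambda>r. norm (a r * rGamma (\<sigma> + \<Upsilon> * of_nat r) * z ^ r))"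
  using Re_\<Upsilon> bound K_nonneg by (rule summable_norm_rGamma_series)

lemma summable_terms: "summable (\<lambda>r. a r * rGamma (\<sigma> + \<Upsilon> * of_nat r) * z ^ r)"
  using summable_norm_terms by (rule summable_norm_cancel)

lemma sums_rGamma_series: "(\<lambda>r. a r * rGamma (\<sigma> + \<Upsilon> * of_nat r) * z ^ r) sums rGamma_series a \<Upsilon> \<sigma> z"
  unfolding rGamma_series_def using summable_terms by (rule summable_sums)

text \<open>\<open>rGamma (u - 1) = (u - 1) * rGamma u\<close> at
  \<open>u = \<sigma> + \<Upsilon> * of_nat r\<close>, valid at poles of Gamma too. The factor
  splits into \<open>\<sigma> - 1\<close> and \<open>\<Upsilon> * of_nat r\<close>; the latter acts
  on \<open>z ^ r\<close> as \<open>\<Upsilon>\<close> times the Euler operator z d/dz.\<close>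

lemma rGamma_series_derivative:
  obtains D where "(rGamma_series a \<Upsilon> \<sigma> has_field_derivative D) (at z)"
    and "rGamma_series a \<Upsilon> (\<sigma> - 1) z = (\<sigma> - 1) * rGamma_series a \<Upsilon> \<sigma> z + \<Upsilon> * z * D"
proof
  let ?c = "\<lambda>r. a r * rGamma (\<sigma> + \<Upsilon> * of_nat r)"
  let ?D = "\<Sum>r. diffs ?c r * z ^ r"
  show "(rGamma_series a \<Upsilon> \<sigma> has_field_derivative ?D) (at z)"
    using termdiffs_strong_converges_everywhere[OF summable_terms[of \<sigma>], of z]
    by (simp add: rGamma_series_def[abs_def])
  have "summable (\<lambda>r. diffs ?c r * z ^ r)"
    using termdiff_converges_all[OF summable_terms[of \<sigma>]] .
  then have "(\<lambda>r. of_nat r * ?c r * z ^ (r - Suc 0)) sums ?D"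
    by (rule diffs_equiv)
  then have "(\<lambda>r. (\<sigma> - 1) * (?c r * z ^ r) + \<Upsilon> * z * (of_nat r * ?c r * z ^ (r - Suc 0)))
      sums ((\<sigma> - 1) * rGamma_series a \<Upsilon> \<sigma> z + \<Upsilon> * z * ?D)"
    by (intro sums_add sums_mult sums_rGamma_series)
  moreover have "(\<sigma> - 1) * (?c r * z ^ r) + \<Upsilon> * z * (of_nat r * ?c r * z ^ (r - Suc 0)) =
      a r * rGamma (\<sigma> - 1 + \<Upsilon> * of_nat r) * z ^ r" for r
  proof -
    have shift: "rGamma (\<sigma> - 1 + \<Upsilon> * of_nat r) = (\<sigma> - 1 + \<Upsilon> * of_nat r) * rGamma (\<sigma> + \<Upsilon> * of_nat r)"
      using rGamma_plus1[of "\<sigma> - 1 + \<Upsilon> * of_nat r"] by (simp add: algebra_simps)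
    \<comment> \<open>At \<open>r = 0\<close> the truncated exponent is harmless thanks to the
      factor \<open>of_nat r\<close>.\<close>
    have pow: "z * (of_nat r * z ^ (r - Suc 0)) = of_nat r * z ^ r"
      by (cases r) auto
    have factor: "(\<sigma> - 1) * (?c r * z ^ r) + \<Upsilon> * z * (of_nat r * ?c r * z ^ (r - Suc 0)) =
        ?c r * ((\<sigma> - 1) * z ^ r + \<Upsilon> * (z * (of_nat r * z ^ (r - Suc 0))))"
      by (simp add: algebra_simps)
    show ?thesis
      unfolding factor shift pow by (simp add: algebra_simps)
  qed
  ultimately show "rGamma_series a \<Upsilon> (\<sigma> - 1) z = (\<sigma> - 1) * rGamma_series a \<Upsilon> \<sigma> z + \<Upsilon> * z * ?D"
    using sums_rGamma_series[of "\<sigma> - 1" z] by (simp add: sums_unique2)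
qed

text \<open>Product and chain rule in a complex variable, then restriction to the real line;
  \<open>x > 0\<close> avoids the branch cut.\<close>

lemma fractional_series_has_vector_derivative:
  assumes "x > 0"
  shows "(fractional_series a \<Upsilon> \<sigma> has_vector_derivative fractional_series a \<Upsilon> (\<sigma> - 1) x) (at x)"
proof -
  let ?z = "complex_of_real x powr \<Upsilon>"
  obtain D where D: "(rGamma_series a \<Upsilon> \<sigma> has_field_derivative D) (at ?z)"
    and D_eq: "rGamma_series a \<Upsilon> (\<sigma> - 1) ?z = (\<sigma> - 1) * rGamma_series a \<Upsilon> \<sigma> ?z + \<Upsilon> * ?z * D"
    by (rule rGamma_series_derivative)
  have powr: "((\<lambda>u. u powr p) has_field_derivative p * of_real x powr (p - 1)) (at (complex_of_real x))" for p
    using assms by (intro has_field_derivative_powr) (auto simp: complex_nonpos_Reals_iff)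
  have "((\<lambda>u. rGamma_series a \<Upsilon> \<sigma> (u powr \<Upsilon>)) has_field_derivative
      D * (\<Upsilon> * of_real x powr (\<Upsilon> - 1))) (at (complex_of_real x))"
    using DERIV_chain2[OF D powr] .
  from DERIV_mult[OF powr[of "\<sigma> - 1"] this]
  have "((\<lambda>u. u powr (\<sigma> - 1) * rGamma_series a \<Upsilon> \<sigma> (u powr \<Upsilon>)) has_field_derivative
      (\<sigma> - 1) * of_real x powr (\<sigma> - 1 - 1) * rGamma_series a \<Upsilon> \<sigma> ?z +
      D * (\<Upsilon> * of_real x powr (\<Upsilon> - 1)) * of_real x powr (\<sigma> - 1)) (at (complex_of_real x))" .
  \<comment> \<open>This exposes the common factor \<open>of_real x powr (\<sigma> - 2)\<close>,
    beside which \<open>D_eq\<close> applies.\<close>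
  moreover have "complex_of_real x powr (\<Upsilon> - 1) * of_real x powr (\<sigma> - 1) = ?z * of_real x powr (\<sigma> - 1 - 1)"
    by (simp add: algebra_simps flip: powr_add)
  ultimately have "((\<lambda>u. u powr (\<sigma> - 1) * rGamma_series a \<Upsilon> \<sigma> (u powr \<Upsilon>)) has_field_derivative
      fractional_series a \<Upsilon> (\<sigma> - 1) x) (at (complex_of_real x))"
    by (simp add: fractional_series_def D_eq algebra_simps)
  from has_vector_derivative_real_field[OF this]
  show ?thesis
    by (simp add: fractional_series_def[abs_def])
qed

end

section \<open>Riemann--Liouville operators on fractional power series\<close>

text \<open>Exchanging sum and integral requires pointwise absolute convergence and summable L1
  norms; both come from \<open>summable_norm_terms\<close>, at \<open>t powr \<Upsilon>\<close> and
  \<open>x powr \<Upsilon>\<close>.\<close>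

lemma (in geometrically_bounded) fractional_series_integral:
  assumes "Re \<sigma> > 0" "Re \<alpha> > 0" "x > 0"
  shows "has_bochner_integral lborel
    (\<lambda>t. indicator {0..x} t *\<^sub>R (of_real (x - t) powr (\<alpha> - 1) * fractional_series a \<Upsilon> \<sigma> t))
    (Gamma \<alpha> * fractional_series a \<Upsilon> (\<sigma> + \<alpha>) x)"
proof -
  let ?b = "\<lambda>r. \<sigma> + \<Upsilon> * of_nat r"
  let ?f = "\<lambda>r t. a r * rGamma (?b r) * beta_kernel (?b r) \<alpha> x t"
  have Re_b: "Re \<sigma> \<le> Re (?b r)" "Re (?b r) > 0" for r
    using assms Re_\<Upsilon> by (simp_all add: add_pos_nonneg)
  have powr_b: "complex_of_real t powr (?b r + p) = of_real t powr (\<sigma> + p) * (of_real t powr \<Upsilon>) ^ r"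
    if "t > 0" for t r p
    using that by (simp add: powr_def exp_add ring_distribs mult_ac flip: exp_of_nat_mult)
  have f: "has_bochner_integral lborel (?f r) (a r * rGamma (?b r) * (pos_powr (?b r + \<alpha> - 1) x * Beta (?b r) \<alpha>))" for r
    using Re_b assms by (intro has_bochner_integral_mult_right has_bochner_integral_beta_kernel) auto
  have f_eq: "?f r t = of_real (x - t) powr (\<alpha> - 1) * of_real t powr (\<sigma> - 1) *
      (a r * rGamma (?b r) * (of_real t powr \<Upsilon>) ^ r)" if "t \<in> {0<..<x}" for r t
    using that powr_b[of t r "-1"] by (simp add: beta_kernel_def pos_powr_def flip: of_real_diff)
  have f_0: "?f r t = 0" if "t \<notin> {0<..<x}" for r t
    using that by (auto simp: beta_kernel_def pos_powr_def)
  have sums_f: "(\<lambda>r. ?f r t) sums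
      (indicator {0..x} t *\<^sub>R (of_real (x - t) powr (\<alpha> - 1) * fractional_series a \<Upsilon> \<sigma> t))" for t
  proof (cases "t \<in> {0<..<x}")
    case True
    then show ?thesis
      unfolding f_eq[OF True]
      using sums_mult[OF sums_rGamma_series, of "of_real (x - t) powr (\<alpha> - 1) * of_real t powr (\<sigma> - 1)" \<sigma> "of_real t powr \<Upsilon>"]
      by (simp add: fractional_series_def mult.assoc)
  next
    case False
    \<comment> \<open>At each endpoint some power has base 0, so the integrand vanishes there as
      well.\<close>
    then have "t \<notin> {0..x} \<or> t = 0 \<or> t = x"
      by auto
    then have outside: "indicator {0..x} t *\<^sub>R (of_real (x - t) powr (\<alpha> - 1) * fractional_series a \<Upsilon> \<sigma> t) = 0"
      by (auto simp: fractional_series_def)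
    show ?thesis
      unfolding outside f_0[OF False] by (rule sums_zero)
  qed
  \<comment> \<open>The L1 norm is a Beta integral at real parts. Since
    \<open>Re (?b r) \<ge> Re \<sigma>\<close>, its Beta factor is bounded independently of
    \<open>r\<close>.\<close>
  have norm_f: "(LINT t|lborel. norm (?f r t)) \<le> x powr (Re \<sigma> + Re \<alpha> - 1) * Beta (Re \<sigma>) (Re \<alpha>) *
      norm (a r * rGamma (?b r) * (of_real x powr \<Upsilon>) ^ r)" (is "?l \<le> ?r") for r
  proof -
    have "complex_of_real ?l = (LINT t|lborel. norm (a r * rGamma (?b r)) * beta_kernel (of_real (Re (?b r))) (of_real (Re \<alpha>)) x t)"
      by (simp only: norm_mult of_real_mult norm_beta_kernel flip: integral_complex_of_real)
    also have "\<dots> = norm (a r * rGamma (?b r)) * (pos_powr (of_real (Re (?b r)) + of_real (Re \<alpha>) - 1) x * Beta (of_real (Re (?b r))) (of_real (Re \<alpha>)))"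
      using Re_b[of r] assms
      by (intro has_bochner_integral_integral_eq has_bochner_integral_mult_right has_bochner_integral_beta_kernel) auto
    also have "\<dots> = complex_of_real (norm (a r * rGamma (?b r)) * (x powr (Re (?b r) + Re \<alpha> - 1) * Beta (Re (?b r)) (Re \<alpha>)))"
    proof -
      have "pos_powr (of_real (Re (?b r)) + of_real (Re \<alpha>) - 1) x = complex_of_real (x powr (Re (?b r) + Re \<alpha> - 1))"
        using \<open>x > 0\<close> powr_of_real[of x "Re (?b r) + Re \<alpha> - 1"] by (simp add: pos_powr_def)
      then show ?thesis
        by (simp only: Beta_complex_of_real of_real_mult)
    qed
    finally have "?l = norm (a r * rGamma (?b r)) * (x powr (Re (?b r) + Re \<alpha> - 1) * Beta (Re (?b r)) (Re \<alpha>))"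
      by (simp only: of_real_eq_iff)
    also have "\<dots> \<le> norm (a r * rGamma (?b r)) * (x powr (Re (?b r) + Re \<alpha> - 1) * Beta (Re \<sigma>) (Re \<alpha>))"
      using Re_b assms by (intro mult_left_mono Beta_real_mono) auto
    also have "x powr (Re (?b r) + Re \<alpha> - 1) = norm (complex_of_real x powr (?b r + (\<alpha> - 1)))"
      using \<open>x > 0\<close> by (subst norm_powr_real_powr) (auto simp: algebra_simps)
    also have "\<dots> = x powr (Re \<sigma> + Re \<alpha> - 1) * norm ((complex_of_real x powr \<Upsilon>) ^ r)"
      unfolding powr_b[OF \<open>x > 0\<close>] norm_mult using \<open>x > 0\<close> by (simp add: norm_powr_real_powr add_diff_eq)
    finally show ?thesis
      by (simp add: norm_mult mult_ac)
  qed
  have int: "integrable lborel (?f r)" for r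
    using f by (simp add: has_bochner_integral_iff)
  have AE_summable: "AE t in lborel. summable (\<lambda>r. norm (?f r t))"
  proof (rule AE_I2)
    fix t
    show "summable (\<lambda>r. norm (?f r t))"
    proof (cases "t \<in> {0<..<x}")
      case True
      have "summable (\<lambda>r. norm (of_real (x - t) powr (\<alpha> - 1) * of_real t powr (\<sigma> - 1)) *
          norm (a r * rGamma (?b r) * (of_real t powr \<Upsilon>) ^ r))"
        by (intro summable_mult summable_norm_terms)
      then show ?thesis
        by (simp only: f_eq[OF True] norm_mult)
    qed (simp add: f_0)
  qed
  have summable_int: "summable (\<lambda>r. LINT t|lborel. norm (?f r t))"
  proof (rule summable_comparison_test'[where N = 0])
    show "summable (\<lambda>r. x powr (Re \<sigma> + Re \<alpha> - 1) * Beta (Re \<sigma>) (Re \<alpha>) *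
        norm (a r * rGamma (?b r) * (of_real x powr \<Upsilon>) ^ r))"
      by (intro summable_mult summable_norm_terms)
    show "norm (LINT t|lborel. norm (?f r t)) \<le> x powr (Re \<sigma> + Re \<alpha> - 1) * Beta (Re \<sigma>) (Re \<alpha>) *
        norm (a r * rGamma (?b r) * (of_real x powr \<Upsilon>) ^ r)" for r
      using norm_f[of r] by simp
  qed
  have f_int: "(LINT t|lborel. ?f r t) = Gamma \<alpha> * of_real x powr (\<sigma> + \<alpha> - 1) *
      (a r * rGamma (\<sigma> + \<alpha> + \<Upsilon> * of_nat r) * (of_real x powr \<Upsilon>) ^ r)" for r
  proof -
    have "(LINT t|lborel. ?f r t) = a r * rGamma (?b r) * (pos_powr (?b r + \<alpha> - 1) x * Beta (?b r) \<alpha>)"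
      using f by (rule has_bochner_integral_integral_eq)
    also have "rGamma (?b r) * Beta (?b r) \<alpha> = Gamma \<alpha> * rGamma (?b r + \<alpha>)"
      using Gamma_nonzero_Re_pos[OF Re_b(2)] by (simp add: Beta_altdef rGamma_inverse_Gamma)
    then have "a r * rGamma (?b r) * (pos_powr (?b r + \<alpha> - 1) x * Beta (?b r) \<alpha>) =
        Gamma \<alpha> * pos_powr (?b r + \<alpha> - 1) x * (a r * rGamma (?b r + \<alpha>))"
      by (simp add: mult_ac)
    also have "pos_powr (?b r + \<alpha> - 1) x = of_real x powr (\<sigma> + \<alpha> - 1) * (of_real x powr \<Upsilon>) ^ r"
      using \<open>x > 0\<close> powr_b[of x r "\<alpha> - 1"] by (simp add: pos_powr_def add_diff_eq)
    finally show ?thesis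
      by (simp add: mult_ac add_ac)
  qed
  have "(\<lambda>r. Gamma \<alpha> * of_real x powr (\<sigma> + \<alpha> - 1) *
      (a r * rGamma (\<sigma> + \<alpha> + \<Upsilon> * of_nat r) * (of_real x powr \<Upsilon>) ^ r)) sums
      (Gamma \<alpha> * fractional_series a \<Upsilon> (\<sigma> + \<alpha>) x)"
    unfolding fractional_series_def mult.assoc[symmetric, of "Gamma \<alpha>"]
    by (intro sums_mult sums_rGamma_series)
  moreover have "(\<lambda>r. LINT t|lborel. ?f r t) sums (LINT t|lborel. (\<Sum>r. ?f r t))"
    using int AE_summable summable_int by (rule sums_integral)
  ultimately have "(LINT t|lborel. (\<Sum>r. ?f r t)) = Gamma \<alpha> * fractional_series a \<Upsilon> (\<sigma> + \<alpha>) x"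
    unfolding f_int by (rule sums_unique2 [rotated])
  moreover have "integrable lborel (\<lambda>t. \<Sum>r. ?f r t)"
    using int AE_summable summable_int by (rule integrable_suminf)
  ultimately show ?thesis
    by (simp add: has_bochner_integral_iff sums_unique[OF sums_f, symmetric])
qed

text \<open>Translation by \<open>B\<close> of the preceding integral. Its absolute integrability is
  the first requirement of \<open>RL_differentiable\<close>.\<close>

lemma (in geometrically_bounded) RL_integral_fractional_series:
  assumes "Re \<sigma> > 0" "Re \<alpha> > 0" "B < y"
    and f: "\<And>t. t \<ge> B \<Longrightarrow> f t = fractional_series a \<Upsilon> \<sigma> (t - B)"
  shows "(\<lambda>t. of_real (y - t) powr (\<alpha> - 1) * f t) absolutely_integrable_on {B..y}"
    and "RL_integral \<alpha> B f y = fractional_series a \<Upsilon> (\<sigma> + \<alpha>) (y - B)"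
proof -
  let ?g = "\<lambda>t. of_real (y - t) powr (\<alpha> - 1) * f t"
  let ?I = "Gamma \<alpha> * fractional_series a \<Upsilon> (\<sigma> + \<alpha>) (y - B)"
  have "has_bochner_integral lborel (\<lambda>t. indicator {B..y} t *\<^sub>R ?g t) ?I"
  proof (subst lborel_has_bochner_integral_real_affine_iff[where c = 1 and t = B])
    have "indicator {B..y} (B + 1 * t) *\<^sub>R (of_real (y - (B + 1 * t)) powr (\<alpha> - 1) * f (B + 1 * t)) =
        indicator {0..y - B} t *\<^sub>R (of_real (y - B - t) powr (\<alpha> - 1) * fractional_series a \<Upsilon> \<sigma> t)" for t
      by (auto simp: indicator_def f algebra_simps)
    then show "has_bochner_integral lborel
        (\<lambda>t. indicator {B..y} (B + 1 * t) *\<^sub>R (of_real (y - (B + 1 * t)) powr (\<alpha> - 1) * f (B + 1 * t))) (?I /\<^sub>R \<bar>1\<bar>)"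
      using fractional_series_integral[of \<sigma> \<alpha> "y - B"] assms(1-3) by simp
  qed simp
  then have lebesgue: "has_bochner_integral lebesgue (\<lambda>t. indicator {B..y} t *\<^sub>R ?g t) ?I"
    by (auto simp: has_bochner_integral_iff integrable_completion integral_completion dest: borel_measurable_integrable)
  then show abs: "?g absolutely_integrable_on {B..y}"
    by (simp add: set_integrable_def has_bochner_integral_iff)
  have "integral {B..y} ?g = ?I"
    using set_lebesgue_integral_eq_integral(2)[OF abs] lebesgue
    by (simp add: set_lebesgue_integral_def has_bochner_integral_iff)
  then show "RL_integral \<alpha> B f y = fractional_series a \<Upsilon> (\<sigma> + \<alpha>) (y - B)"
    using Gamma_nonzero_Re_pos[OF \<open>Re \<alpha> > 0\<close>] by (simp add: RL_integral_def)
qed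

text \<open>The formula for \<open>g\<close> holds on an open half-line and so determines the
  derivatives there; the induction therefore carries it for all \<open>y > B\<close> at
  once.\<close>

lemma (in geometrically_bounded) nth_derivative_fractional_series:
  assumes g: "\<And>y. y > B \<Longrightarrow> g y = fractional_series a \<Upsilon> \<sigma> (y - B)" and "y > B"
  shows "nth_derivative k g y = fractional_series a \<Upsilon> (\<sigma> - of_nat k) (y - B)"
    and "nth_derivative k g differentiable (at y)"
proof -
  have deriv: "(h has_vector_derivative fractional_series a \<Upsilon> (\<tau> - 1) (y - B)) (at y)"
    if "\<And>y. y > B \<Longrightarrow> h y = fractional_series a \<Upsilon> \<tau> (y - B)" "y > B" for h \<tau> y
  proof (rule has_vector_derivative_transform_within_open[where S = "{B<..}"])
    have "((\<lambda>y. y - B) has_vector_derivative 1) (at y)"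
      by (auto intro!: derivative_eq_intros)
    from vector_diff_chain_at[OF this fractional_series_has_vector_derivative[of "y - B" \<tau>]]
    show "((\<lambda>y. fractional_series a \<Upsilon> \<tau> (y - B)) has_vector_derivative
        fractional_series a \<Upsilon> (\<tau> - 1) (y - B)) (at y)"
      using that(2) by (simp add: o_def)
  qed (use that in auto)
  have eq: "nth_derivative k g y = fractional_series a \<Upsilon> (\<sigma> - of_nat k) (y - B)" if "y > B" for y k
    using that
  proof (induction k arbitrary: y)
    case 0
    then show ?case
      using g by (simp add: nth_derivative_def)
  next
    case (Suc k)
    have "nth_derivative (Suc k) g y = vector_derivative (nth_derivative k g) (at y)"
      by (simp add: nth_derivative_def)
    also have "\<dots> = fractional_series a \<Upsilon> (\<sigma> - of_nat k - 1) (y - B)"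
      using Suc by (intro vector_derivative_at deriv) auto
    finally show ?case
      by (simp add: algebra_simps)
  qed
  show "nth_derivative k g y = fractional_series a \<Upsilon> (\<sigma> - of_nat k) (y - B)"
    using \<open>y > B\<close> by (rule eq)
  show "nth_derivative k g differentiable (at y)"
    using deriv[OF eq \<open>y > B\<close>] by (rule differentiableI_vector)
qed

lemma RL_order_minus_pos: "Re \<mu> > 0 \<Longrightarrow> Re (of_nat (RL_order \<mu>) - \<mu>) > 0"
  unfolding RL_order_def by (simp add: of_nat_nat) linarith

lemma (in geometrically_bounded) RL_derivative_fractional_series:
  assumes "Re \<sigma> > 0" "Re \<mu> > 0"
    and f: "\<And>t. t \<ge> B \<Longrightarrow> f t = fractional_series a \<Upsilon> \<sigma> (t - B)"
  shows "RL_differentiable \<mu> B f"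
    and "y > B \<Longrightarrow> RL_derivative \<mu> B f y = fractional_series a \<Upsilon> (\<sigma> - \<mu>) (y - B)"
proof -
  let ?n = "RL_order \<mu>"
  note int = RL_integral_fractional_series[OF assms(1) RL_order_minus_pos[OF assms(2)] _ f]
  show "RL_differentiable \<mu> B f"
    unfolding RL_differentiable_def
    using int(1) nth_derivative_fractional_series(2)[OF int(2)] by auto
  show "RL_derivative \<mu> B f y = fractional_series a \<Upsilon> (\<sigma> - \<mu>) (y - B)" if "y > B"
    using nth_derivative_fractional_series(1)[OF int(2) that, of ?n]
    by (simp add: RL_derivative_def algebra_simps)
qed

section \<open>The H--K Mittag-Leffler function\<close>

lemma pochhammer_nonzero_Re_pos: "Re c > 0 \<Longrightarrow> pochhammer c n \<noteq> 0"
  by (auto simp: pochhammer_eq_0_iff)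

text \<open>Factorwise,
  \<open>norm (c + of_nat r) \<le> (norm c + 1) * real (Suc r)\<close>.\<close>

lemma norm_pochhammer_le:
  fixes c :: complex
  shows "norm (pochhammer c r) \<le> (norm c + 1) ^ r * fact r"
proof (induction r)
  case (Suc r)
  have "norm (c + of_nat r) \<le> norm c + real r"
    by (rule order_trans[OF norm_triangle_ineq]) simp
  also have "\<dots> \<le> (norm c + 1) * real (Suc r)"
    by (simp add: algebra_simps)
  finally have "norm (pochhammer c r) * norm (c + of_nat r)
      \<le> ((norm c + 1) ^ r * fact r) * ((norm c + 1) * real (Suc r))"
    using Suc by (intro mult_mono) auto
  then show ?case
    by (simp add: pochhammer_Suc norm_mult mult_ac)
qed simp

text \<open>The part of \<open>HK_term\<close> free of \<open>\<rho>\<close> and of the real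
  variable; \<open>v\<close> will be \<open>w powr \<Upsilon>\<close>.\<close>

definition HK_coeff :: "complex \<Rightarrow> complex \<Rightarrow> complex \<Rightarrow> nat \<Rightarrow> complex \<Rightarrow> nat \<Rightarrow> complex" where
  "HK_coeff \<gamma>1 \<gamma>2 \<gamma>3 s v r =
     pochhammer \<gamma>1 (2 * s) * pochhammer \<gamma>2 (s + r) / (pochhammer \<gamma>3 s * fact r * fact s) * v ^ r"

text \<open>Splitting off \<open>pochhammer \<gamma>2 s\<close> leaves
  \<open>pochhammer (\<gamma>2 + of_nat s) r\<close>, whose quotient by \<open>fact r\<close> grows
  at most geometrically.\<close>

lemma geometrically_bounded_HK_coeff:
  assumes "Re \<Upsilon> > 0"
  shows "geometrically_bounded (HK_coeff \<gamma>1 \<gamma>2 \<gamma>3 s v) \<Upsilon>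
    (norm (pochhammer \<gamma>1 (2 * s) * pochhammer \<gamma>2 s / (pochhammer \<gamma>3 s * fact s)))
    ((norm (\<gamma>2 + of_nat s) + 1) * norm v)" (is "geometrically_bounded _ _ ?C ?K")
proof
  fix r
  have "norm (HK_coeff \<gamma>1 \<gamma>2 \<gamma>3 s v r) =
      ?C * (norm (pochhammer (\<gamma>2 + of_nat s) r) / fact r) * norm v ^ r"
    by (simp add: HK_coeff_def pochhammer_product' norm_mult norm_divide norm_power mult_ac)
  also have "\<dots> \<le> ?C * (norm (\<gamma>2 + of_nat s) + 1) ^ r * norm v ^ r"
    using norm_pochhammer_le[of "\<gamma>2 + of_nat s" r]
    by (intro mult_right_mono mult_left_mono) (auto simp: divide_simps)
  finally show "norm (HK_coeff \<gamma>1 \<gamma>2 \<gamma>3 s v r) \<le> ?C * ?K ^ r"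
    by (simp add: power_mult_distrib mult.assoc)
qed (use assms in auto)

text \<open>A principal power of a product splits when one factor is real and nonnegative.\<close>

lemma HK_term_conv_HK_coeff:
  assumes "x \<ge> 0"
  shows "HK_term \<gamma>1 \<gamma>2 \<gamma>3 \<rho> \<Upsilon> (w * of_real x) s r =
    HK_coeff \<gamma>1 \<gamma>2 \<gamma>3 s (w powr \<Upsilon>) r * rGamma (\<rho> + \<Upsilon> * of_nat r) * (of_real x powr \<Upsilon>) ^ r"
proof -
  have "(w * of_real x) powr \<Upsilon> = w powr \<Upsilon> * of_real x powr \<Upsilon>"
    using assms powr_times_real_left[of "of_real x" w \<Upsilon>] by (simp add: mult.commute)
  then show ?thesis
    by (simp add: HK_term_def HK_coeff_def power_mult_distrib)
qed

lemma HK_fps_nth_conv_fractional_series: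
  assumes "x \<ge> 0"
  shows "of_real x powr (\<rho> - 1) * fps_nth (HK_fps \<gamma>1 \<gamma>2 \<gamma>3 \<rho> \<Upsilon> (w * of_real x)) s =
    fractional_series (HK_coeff \<gamma>1 \<gamma>2 \<gamma>3 s (w powr \<Upsilon>)) \<Upsilon> \<rho> x"
  by (simp add: HK_fps_def fractional_series_def rGamma_series_def HK_term_conv_HK_coeff[OF assms])

section \<open>Values of the double series\<close>

lemma HK_ML_0:
  assumes "Re \<Upsilon> > 0"
  shows "HK_ML \<gamma>1 \<gamma>2 \<gamma>3 \<rho> \<Upsilon> 0 Y = fps_nth (HK_fps \<gamma>1 \<gamma>2 \<gamma>3 \<rho> \<Upsilon> Y) 0"
proof -
  interpret geometrically_bounded "HK_coeff \<gamma>1 \<gamma>2 \<gamma>3 0 (Y powr \<Upsilon>)" \<Upsilon>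
    "norm (pochhammer \<gamma>1 (2 * 0) * pochhammer \<gamma>2 0 / (pochhammer \<gamma>3 0 * fact 0))"
    "(norm (\<gamma>2 + of_nat 0) + 1) * norm (Y powr \<Upsilon>)"
    using assms by (rule geometrically_bounded_HK_coeff)
  let ?t = "\<lambda>(s, r). HK_term \<gamma>1 \<gamma>2 \<gamma>3 \<rho> \<Upsilon> Y s r * 0 ^ s"
  \<comment> \<open>Taking \<open>x = 1\<close> and \<open>w = Y\<close> turns the terms into those
    of the series at \<open>z = 1\<close>.\<close>
  have "summable (\<lambda>r. norm (HK_term \<gamma>1 \<gamma>2 \<gamma>3 \<rho> \<Upsilon> Y 0 r))"
    using summable_norm_terms[of \<rho> 1] HK_term_conv_HK_coeff[of 1 \<gamma>1 \<gamma>2 \<gamma>3 \<rho> \<Upsilon> Y 0] by simp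
  from norm_summable_imp_has_sum[OF this summable_sums[OF summable_norm_cancel[OF this]]]
  have "infsum (HK_term \<gamma>1 \<gamma>2 \<gamma>3 \<rho> \<Upsilon> Y 0) UNIV = fps_nth (HK_fps \<gamma>1 \<gamma>2 \<gamma>3 \<rho> \<Upsilon> Y) 0"
    by (simp add: infsumI HK_fps_def)
  \<comment> \<open>The factor \<open>0 ^ s\<close> is 1 for \<open>s = 0\<close> and 0
    otherwise.\<close>
  moreover have "infsum ?t UNIV = infsum ?t (Pair 0 ` UNIV)"
    by (rule infsum_cong_neutral) (auto simp: image_iff power_0_left)
  moreover have "\<dots> = infsum (?t \<circ> Pair 0) UNIV"
    by (rule infsum_reindex) (auto simp: inj_on_def)
  ultimately show ?thesis
    by (simp add: HK_ML_def o_def)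
qed

text \<open>The quotient \<open>?q s\<close> of consecutive terms grows linearly in
  \<open>s\<close>, so from some index on the moduli do not decrease.\<close>

lemma HK_terms_not_tendsto_0:
  assumes "Re \<gamma>1 > 0" "Re \<gamma>2 > 0" "Re \<gamma>3 > 0" "X \<noteq> 0" "d \<noteq> 0"
  shows "\<not> (\<lambda>s. d * (pochhammer \<gamma>1 (2 * s) * pochhammer \<gamma>2 (s + r) / (pochhammer \<gamma>3 s * fact s) * X ^ s))
    \<longlonglongrightarrow> (0 :: complex)"
proof
  let ?t = "\<lambda>s. d * (pochhammer \<gamma>1 (2 * s) * pochhammer \<gamma>2 (s + r) / (pochhammer \<gamma>3 s * fact s) * X ^ s)"
  let ?q = "\<lambda>s. (\<gamma>1 + of_nat (2 * s)) * (\<gamma>1 + of_nat (Suc (2 * s))) * (\<gamma>2 + of_nat (s + r)) /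
      ((\<gamma>3 + of_nat s) * of_nat (Suc s)) * X"
  \<comment> \<open>For \<open>s \<ge> N\<close> the denominator is at most
    \<open>2 * s * (s + 1)\<close> in modulus and the three numerator factors give at least
    \<open>s * (s + 1) * s\<close>, so \<open>norm (?q s) \<ge> s * norm X / 2 \<ge> 1\<close>. The
    summand 1 ensures \<open>s > 0\<close>.\<close>
  obtain N :: nat where N: "real N \<ge> norm \<gamma>3 + 2 / norm X + 1"
    using real_arch_simple by blast
  have q: "norm (?q s) \<ge> 1" if "s \<ge> N" for s
  proof -
    have s: "real s \<ge> norm \<gamma>3 + 2 / norm X + 1"
      using N that by linarith
    have "2 / norm X \<ge> 0"
      by simp
    with s have s': "real s \<ge> norm \<gamma>3" "real s \<ge> 2 / norm X" "real s > 0"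
      using norm_ge_zero[of \<gamma>3] by linarith+
    have "norm (\<gamma>1 + of_nat (2 * s)) \<ge> real s"
      using assms s' by (intro order_trans[OF _ complex_Re_le_cmod]) simp
    moreover have "norm (\<gamma>1 + of_nat (Suc (2 * s))) \<ge> real (Suc s)"
      using assms s' by (intro order_trans[OF _ complex_Re_le_cmod]) simp
    moreover have "norm (\<gamma>2 + of_nat (s + r)) \<ge> real s"
      using assms s' by (intro order_trans[OF _ complex_Re_le_cmod]) simp
    ultimately have num: "norm (\<gamma>1 + of_nat (2 * s)) * norm (\<gamma>1 + of_nat (Suc (2 * s))) * norm (\<gamma>2 + of_nat (s + r))
        \<ge> real s * real (Suc s) * real s"
      by (intro mult_mono) auto
    have "norm (\<gamma>3 + of_nat s) \<le> 2 * real s"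
      using s' norm_triangle_ineq[of \<gamma>3 "of_nat s"] by simp
    then have den: "norm (\<gamma>3 + of_nat s) * real (Suc s) \<le> 2 * real s * real (Suc s)"
      by (intro mult_right_mono) auto
    have "Re (\<gamma>3 + of_nat s) > 0"
      using assms by (simp add: add_pos_nonneg)
    then have "\<gamma>3 + of_nat s \<noteq> 0"
      by (metis less_irrefl zero_complex.sel(1))
    then have den_pos: "norm (\<gamma>3 + of_nat s) * real (Suc s) > 0"
      by (intro mult_pos_pos) auto
    have "1 \<le> real s * norm X / 2"
      using s' \<open>X \<noteq> 0\<close> by (simp add: field_simps)
    also have "\<dots> = real s * real (Suc s) * real s / (2 * real s * real (Suc s)) * norm X"
      using s' by (simp add: field_simps del: of_nat_Suc)
    also have "\<dots> \<le> norm (\<gamma>1 + of_nat (2 * s)) * norm (\<gamma>1 + of_nat (Suc (2 * s))) * norm (\<gamma>2 + of_nat (s + r)) /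
        (norm (\<gamma>3 + of_nat s) * real (Suc s)) * norm X"
      using num den den_pos by (intro mult_right_mono frac_le) auto
    also have "\<dots> = norm (?q s)"
      by (simp only: norm_mult norm_divide norm_of_nat)
    finally show ?thesis .
  qed
  have t_Suc: "?t (Suc s) = ?q s * ?t s" for s
    by (simp add: pochhammer_Suc mult_ac)
  have t_mono: "norm (?t s) \<ge> norm (?t N)" if "s \<ge> N" for s
    using that
  proof (induction s rule: dec_induct)
    case (step s)
    have "norm (?t s) \<le> norm (?q s) * norm (?t s)"
      using mult_right_mono[OF q[OF step(1)], of "norm (?t s)"] by simp
    also have "\<dots> = norm (?t (Suc s))"
      unfolding t_Suc by (rule norm_mult [symmetric])
    finally show ?case
      using step by linarith
  qed simp
  assume "?t \<longlonglongrightarrow> 0"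
  then have "(\<lambda>s. norm (?t s)) \<longlonglongrightarrow> 0"
    by (rule tendsto_norm_zero)
  \<comment> \<open>This contradicts \<open>?t N\<close> being nonzero: Pochhammer symbols of
    numbers with positive real part do not vanish.\<close>
  then have "norm (?t N) \<le> 0"
    using t_mono by (intro LIMSEQ_le_const) auto
  then show False
    using assms by (simp add: pochhammer_nonzero_Re_pos)
qed

text \<open>Subfamilies of a summable family are summable, but one index \<open>r\<close> with a
  nonzero factor already gives a family in \<open>s\<close> whose terms do not tend to 0.\<close>

lemma HK_ML_eq_0:
  assumes "Re \<gamma>1 > 0" "Re \<gamma>2 > 0" "Re \<gamma>3 > 0" "X \<noteq> 0"
  shows "HK_ML \<gamma>1 \<gamma>2 \<gamma>3 \<rho> \<Upsilon> X Y = 0"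
\<comment> \<open>All factors vanish, for instance, if \<open>Y = 0\<close> and
  \<open>\<rho>\<close> is a pole of Gamma.\<close>
proof (cases "\<forall>r. (Y powr \<Upsilon>) ^ r * rGamma (\<rho> + \<Upsilon> * of_nat r) = 0")
  case True
  then have "HK_term \<gamma>1 \<gamma>2 \<gamma>3 \<rho> \<Upsilon> Y s r = 0" for s r
    by (auto simp: HK_term_def)
  then show ?thesis
    by (simp add: HK_ML_def case_prod_unfold)
next
  case False
  then obtain r where r: "(Y powr \<Upsilon>) ^ r * rGamma (\<rho> + \<Upsilon> * of_nat r) \<noteq> 0"
    by blast
  let ?t = "\<lambda>(s, r). HK_term \<gamma>1 \<gamma>2 \<gamma>3 \<rho> \<Upsilon> Y s r * X ^ s"
  let ?d = "(Y powr \<Upsilon>) ^ r * rGamma (\<rho> + \<Upsilon> * of_nat r) / fact r"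
  have "\<not> ?t summable_on UNIV"
  proof
    assume "?t summable_on UNIV"
    then have "?t summable_on (\<lambda>s. (s, r)) ` UNIV"
      by (rule summable_on_subset) auto
    then have "(?t \<circ> (\<lambda>s. (s, r))) summable_on UNIV"
      by (subst (asm) summable_on_reindex) (auto simp: inj_on_def)
    then have "(\<lambda>s. HK_term \<gamma>1 \<gamma>2 \<gamma>3 \<rho> \<Upsilon> Y s r * X ^ s) \<longlonglongrightarrow> 0"
      by (intro summable_LIMSEQ_zero summable_on_imp_summable) (simp add: o_def)
    moreover have "(\<lambda>s. HK_term \<gamma>1 \<gamma>2 \<gamma>3 \<rho> \<Upsilon> Y s r * X ^ s) =
        (\<lambda>s. ?d * (pochhammer \<gamma>1 (2 * s) * pochhammer \<gamma>2 (s + r) / (pochhammer \<gamma>3 s * fact s) * X ^ s))"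
      by (simp add: HK_term_def mult_ac)
    moreover have "?d \<noteq> 0"
      using r by simp
    ultimately show False
      using HK_terms_not_tendsto_0[OF assms, of ?d r] by argo
  qed
  then show ?thesis
    unfolding HK_ML_def by (rule infsum_not_exists)
qed

theorem theorem10:
  fixes \<gamma>1 \<gamma>2 \<gamma>3 \<rho> \<Upsilon> \<mu> w :: complex and B :: real
  assumes "Re \<gamma>1 > 0" and "Re \<gamma>2 > 0" and "Re \<gamma>3 > 0"
    and "Re \<rho> > 0" and "Re \<Upsilon> > 0" and "Re \<mu> > 0"
  shows
    "(\<forall>X :: complex.
        let f = (\<lambda>t. complex_of_real (t - B) powr (\<rho> - 1)
                       * HK_ML \<gamma>1 \<gamma>2 \<gamma>3 \<rho> \<Upsilon> X (w * of_real (t - B)))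
        in RL_differentiable \<mu> B f \<and>
           (\<forall>Y>B. RL_derivative \<mu> B f Y =
              complex_of_real (Y - B) powr (\<rho> - \<mu> - 1)
                * HK_ML \<gamma>1 \<gamma>2 \<gamma>3 (\<rho> - \<mu>) \<Upsilon> X (w * of_real (Y - B)))) \<and>
     (\<forall>s :: nat.
        let f = (\<lambda>t. complex_of_real (t - B) powr (\<rho> - 1)
                       * fps_nth (HK_fps \<gamma>1 \<gamma>2 \<gamma>3 \<rho> \<Upsilon> (w * of_real (t - B))) s)
        in RL_differentiable \<mu> B f \<and>
           (\<forall>Y>B. RL_derivative \<mu> B f Y =
              complex_of_real (Y - B) powr (\<rho> - \<mu> - 1)
                * fps_nth (HK_fps \<gamma>1 \<gamma>2 \<gamma>3 (\<rho> - \<mu>) \<Upsilon> (w * of_real (Y - B))) s))"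
proof -
  have RL: "RL_differentiable \<mu> B f \<and> (\<forall>Y>B. RL_derivative \<mu> B f Y = g Y)"
    if "geometrically_bounded a \<Upsilon> C K"
      and "\<And>t. t \<ge> B \<Longrightarrow> f t = fractional_series a \<Upsilon> \<rho> (t - B)"
      and "\<And>t. t \<ge> B \<Longrightarrow> g t = fractional_series a \<Upsilon> (\<rho> - \<mu>) (t - B)"
    for a C K f g
    using geometrically_bounded.RL_derivative_fractional_series[OF that(1) assms(4,6) that(2)] that(3)
    by auto
  have fps: "RL_differentiable \<mu> B (\<lambda>t. complex_of_real (t - B) powr (\<rho> - 1)
        * fps_nth (HK_fps \<gamma>1 \<gamma>2 \<gamma>3 \<rho> \<Upsilon> (w * of_real (t - B))) s) \<and>
      (\<forall>Y>B. RL_derivative \<mu> B (\<lambda>t. complex_of_real (t - B) powr (\<rho> - 1)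
          * fps_nth (HK_fps \<gamma>1 \<gamma>2 \<gamma>3 \<rho> \<Upsilon> (w * of_real (t - B))) s) Y =
        complex_of_real (Y - B) powr (\<rho> - \<mu> - 1)
          * fps_nth (HK_fps \<gamma>1 \<gamma>2 \<gamma>3 (\<rho> - \<mu>) \<Upsilon> (w * of_real (Y - B))) s)" for s
    by (rule RL[OF geometrically_bounded_HK_coeff[OF assms(5)]])
       (rule HK_fps_nth_conv_fractional_series, simp)+
  \<comment> \<open>The zero function is the fractional series with zero coefficients; this settles
    \<open>X \<noteq> 0\<close>.\<close>
  have zero: "RL_differentiable \<mu> B (\<lambda>t. 0) \<and> (\<forall>Y>B. RL_derivative \<mu> B (\<lambda>t. 0) Y = 0)"
  proof (rule RL)
    show "geometrically_bounded (\<lambda>_. 0) \<Upsilon> 0 0"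
      using assms(5) by unfold_locales auto
  qed (simp_all add: fractional_series_def rGamma_series_def)
  show ?thesis
    unfolding Let_def
  proof (intro conjI[OF allI allI])
    fix X
    show "RL_differentiable \<mu> B (\<lambda>t. complex_of_real (t - B) powr (\<rho> - 1)
        * HK_ML \<gamma>1 \<gamma>2 \<gamma>3 \<rho> \<Upsilon> X (w * of_real (t - B))) \<and>
      (\<forall>Y>B. RL_derivative \<mu> B (\<lambda>t. complex_of_real (t - B) powr (\<rho> - 1)
          * HK_ML \<gamma>1 \<gamma>2 \<gamma>3 \<rho> \<Upsilon> X (w * of_real (t - B))) Y =
        complex_of_real (Y - B) powr (\<rho> - \<mu> - 1)
          * HK_ML \<gamma>1 \<gamma>2 \<gamma>3 (\<rho> - \<mu>) \<Upsilon> X (w * of_real (Y - B)))"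
    proof (cases "X = 0")
      case True
      then show ?thesis
        unfolding True HK_ML_0[OF assms(5)] by (intro fps)
    next
      case False
      then show ?thesis
        unfolding HK_ML_eq_0[OF assms(1-3) False] mult_zero_right by (intro zero)
    qed
  qed (rule fps)
qed

end
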